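(* For all $n\ge 1$, $\mathcal D_n\subseteq\mathcal E_n$.
   Context: Let $N=\{1,\dots,n\}$. Matrices are complex; positive definite (PD) matrices are Hermitian. For an $n\times n$ matrix $A$ and $S\subseteq N$, $A[S]$ is the principal submatrix in rows and columns $S$, with $\det A[\emptyset]=1$. Given finitely many index sets $\alpha_1,\dots,\alpha_p\subseteq N$ and exponents $\eta_1,\dots,\eta_p>0$ put $\alpha(A)=\prod_{i=1}^p(\det A[\alpha_i])^{\eta_i}$. A ratio $\frac{\alpha}{\beta}$ is the function $A\mapsto \alpha(A)/\beta(A)$ on $n\times n$ PD matrices, for two such products $\alpha,\beta$. The formal logarithm $\log(\frac{\alpha}{\beta})\in\mathbb R^{(2^N)}$ is the vector indexed by the subsets of $N$ whose entry at a nonempty $S$ is the total exponent of $S$ in $\alpha$ minus that in $\beta$, and whose entry at $\emptyset$ is chosen so that all entries sum to $0$; this entry is called the exponent of the subset in the ratio. Ratios are identified when they have the same formal logarithm. A ratio is homogeneous if $\alpha(D)/\beta(D)=1$ for every PD diagonal matrix $D$. For a matrix $M$ with $n$ columns, its nullity type $\operatorname{nul}(M)\in\mathbb R^{(2^N)}$ is the vector whose entry at $T\subseteq N$ is the dimension of the null space of the submatrix of $M$ formed by the columns in $T$ (entry $0$ for $T=\emptyset$). $\mathcal D_n$ is the set of homogeneous ratios $\frac{\alpha}{\beta}$ such that $\log(\frac{\alpha}{\beta})^T\nu\ge 0$ for every nullity type $\nu$ of a matrix with $n$ columns. $\mathcal E_n$ is the set of ratios satisfying, for every $S\subseteq N$,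 both: (ST1) the sum of the exponents in $\frac{\alpha}{\beta}$ of all $T$ with $S\subseteq T\subseteq N$ is nonnegative; and (ST2) the sum of the exponents in $\frac{\alpha}{\beta}$ of all $T\subseteq S$ (including $T=\emptyset$) is nonnegative. *)

theory Defs
  imports
    "Jordan_Normal_Form.DL_Submatrix"
    "Jordan_Normal_Form.Matrix_Kernel"
    "Jordan_Normal_Form.Schur_Decomposition"
begin

text \<open>
  Rows and columns of matrices are numbered from 0, so the ground set is
  \<open>{..<n}\<close> rather than \<open>{1..n}\<close>.
\<close>

definition pos_def_mat :: "nat \<Rightarrow> complex mat \<Rightarrow> bool" where
  "pos_def_mat n A \<longleftrightarrow>
     A \<in> carrier_mat n n \<and> mat_adjoint A = A \<and>
     (\<forall>v \<in> carrier_vec n. v \<noteq> 0\<^sub>v n \<longrightarrow> Re ((A *\<^sub>v v) \<bullet>c v) > 0)"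

text \<open>
  A list of pairs \<open>(\<alpha>\<^sub>i, \<eta>\<^sub>i)\<close> stands for the product of the powers
  \<open>(det A[\<alpha>\<^sub>i])\<close> to the \<open>\<eta>\<^sub>i\<close>; the same index set may occur several times.
\<close>

type_synonym minor_product = "(nat set \<times> real) list"

definition minor_products :: "nat \<Rightarrow> minor_product set" where
  "minor_products n = {\<alpha>. \<forall>(S, \<eta>) \<in> set \<alpha>. S \<subseteq> {..<n} \<and> \<eta> > 0}"

text \<open>
  Principal minors of positive definite matrices are positive reals, so passing to
  real parts loses nothing there. The empty minor is the determinant of the
  \<open>0 \<times> 0\<close> matrix, which is 1.
\<close>

definition product_value :: "minor_product \<Rightarrow> complex mat \<Rightarrow> real" where
  "product_value \<alpha> A = (\<Prod>(S, \<eta>) \<leftarrow> \<alpha>. Re (det (submatrix A S S)) powr \<eta>)"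

definition total_exponent :: "minor_product \<Rightarrow> nat set \<Rightarrow> real" where
  "total_exponent \<alpha> S = (\<Sum>(T, \<eta>) \<leftarrow> \<alpha>. if T = S then \<eta> else 0)"

text \<open>A pair \<open>(\<alpha>, \<beta>)\<close> is an expression for the ratio of \<open>\<alpha>\<close> to \<open>\<beta>\<close>.\<close>

type_synonym ratio_expr = "minor_product \<times> minor_product"

definition ratio_exprs :: "nat \<Rightarrow> ratio_expr set" where
  "ratio_exprs n = minor_products n \<times> minor_products n"

definition ratio_value :: "ratio_expr \<Rightarrow> complex mat \<Rightarrow> real" where
  "ratio_value r A = product_value (fst r) A / product_value (snd r) A"

definition formal_log :: "nat \<Rightarrow> ratio_expr \<Rightarrow> nat set \<Rightarrow> real" where
  "formal_log n r S =
     (if S = {}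
      then - (\<Sum>T \<in> Pow {..<n} - {{}}. total_exponent (fst r) T - total_exponent (snd r) T)
      else total_exponent (fst r) S - total_exponent (snd r) S)"

text \<open>
  Expressions with the same formal logarithm are the same ratio: a ratio is an
  equivalence class of expressions.
\<close>

definition ratio_rel :: "nat \<Rightarrow> (ratio_expr \<times> ratio_expr) set" where
  "ratio_rel n = {(r, s). r \<in> ratio_exprs n \<and> s \<in> ratio_exprs n \<and>
     (\<forall>S \<subseteq> {..<n}. formal_log n r S = formal_log n s S)}"

lemma equiv_ratio_rel: "equiv (ratio_exprs n) (ratio_rel n)"
  by (rule equivI) (auto simp: ratio_rel_def refl_on_def sym_def trans_def)

definition ratio_class :: "nat \<Rightarrow> ratio_expr \<Rightarrow> ratio_expr set" where
  "ratio_class n r = ratio_rel n `` {r}"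

definition homogeneous_ratio :: "nat \<Rightarrow> ratio_expr \<Rightarrow> bool" where
  "homogeneous_ratio n r \<longleftrightarrow>
     (\<forall>D. pos_def_mat n D \<and> diagonal_mat D \<longrightarrow> ratio_value r D = 1)"

text \<open>For \<open>T = {}\<close> the submatrix has no columns, and \<open>kernel_dim\<close> is 0.\<close>

definition nullity_type :: "complex mat \<Rightarrow> nat set \<Rightarrow> real" where
  "nullity_type M T = real (kernel_dim (submatrix M UNIV T))"

definition \<D> :: "nat \<Rightarrow> ratio_expr set set" where
  "\<D> n = ratio_class n ` {r \<in> ratio_exprs n. homogeneous_ratio n r \<and>
     (\<forall>M. dim_col M = n \<longrightarrow>
        (\<Sum>T \<in> Pow {..<n}. formal_log n r T * nullity_type M T) \<ge> 0)}"

definition \<E> :: "nat \<Rightarrow> ratio_expr set set" where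
  "\<E> n = ratio_class n ` {r \<in> ratio_exprs n. \<forall>S \<subseteq> {..<n}.
     (\<Sum>T | S \<subseteq> T \<and> T \<subseteq> {..<n}. formal_log n r T) \<ge> 0 \<and>
     (\<Sum>T \<in> Pow S. formal_log n r T) \<ge> 0}"

end

theory Submission
  imports Defs
begin

text \<open>
  Write \<open>c\<close> for the formal logarithm of a ratio in \<open>\<D> n\<close>. The pairing of \<open>c\<close> with
  the nullity type of every matrix is nonnegative, so each inequality that defines
  \<open>\<E> n\<close> follows once the indicator function in it is seen to be a nullity type, up to
  set functions on which \<open>c\<close> vanishes.

  Two kinds of set functions pair to zero with \<open>c\<close>. Constants do, because the exponent
  of the empty set is chosen so that all exponents sum to zero. Cardinality does as well:
  evaluating the ratio at the diagonal matrix with a single entry 2 and all others 1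
  gives 2 to the power \<open>\<Sum>T\<ni>i. c T\<close>, so homogeneity makes this sum vanish for each
  index \<open>i\<close>, and summing over \<open>i\<close> gives \<open>\<Sum>T. c T * card T = 0\<close>.

  For the supersets of a nonempty \<open>S\<close>, take a matrix whose columns in \<open>S\<close> form a
  circuit while all other columns are independent of everything else: the columns in
  \<open>T\<close> have nullity 1 if \<open>S \<subseteq> T\<close> and 0 otherwise (\<open>nullity_type_circuit_mat\<close>). The case
  \<open>S = {}\<close> is the sum of all exponents. For the subsets of \<open>S\<close>, take a single row that
  vanishes exactly on \<open>S\<close>: its nullity on \<open>T\<close> is \<open>card T - 1\<close>, plus 1 if \<open>T \<subseteq> S\<close>
  (\<open>nullity_type_cocircuit_row\<close>), and the part \<open>card T - 1\<close> pairs to zero with \<open>c\<close>.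
\<close>

section \<open>Kernel dimensions\<close>

lemma rank_nullity_mat_kernel:
  fixes A :: "'a :: field mat"
  assumes A: "A \<in> carrier_mat nr nc"
  shows "vectorspace.dim class_ring
           (module_vec TYPE('a) nr\<lparr>carrier := (\<lambda>v. A *\<^sub>v v) ` carrier_vec nc\<rparr>) + kernel_dim A = nc"
proof -
  interpret kernel nr nc A by unfold_locales (rule A)
  interpret W: vec_space "TYPE('a)" nr .
  interpret lm: linear_map class_ring "module_vec TYPE('a) nc" "module_vec TYPE('a) nr" "\<lambda>v. A *\<^sub>v v"
  proof unfold_locales
    show "(\<lambda>v. A *\<^sub>v v) \<in> module_hom class_ring (module_vec TYPE('a) nc) (module_vec TYPE('a) nr)"
      using A by (auto simp: module_hom_def module_vec_simps mult_add_distrib_mat_vec mult_mat_vec)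
  qed
  have "lm.im = (\<lambda>v. A *\<^sub>v v) ` carrier_vec nc"
    by (simp add: lm.im_def module_vec_simps)
  moreover have "lm.ker = mat_kernel A"
    using A by (auto simp: lm.ker_def mat_kernel module_vec_simps)
  ultimately show ?thesis
    using lm.rank_nullity[OF NC.fin_dim] by (simp add: NC.dim_is_n)
qed

text \<open>A nonzero row is a surjective functional, so rank-nullity gives a hyperplane.\<close>

lemma kernel_dim_nonzero_row:
  fixes A :: "'a :: field mat"
  assumes A: "A \<in> carrier_mat 1 nc" and j: "j < nc" "A $$ (0, j) \<noteq> 0"
  shows "kernel_dim A = nc - 1"
proof -
  interpret W: vec_space "TYPE('a)" 1 .
  have "w \<in> (\<lambda>v. A *\<^sub>v v) ` carrier_vec nc" if "w \<in> carrier_vec 1" for w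
  proof (rule image_eqI)
    show "w = A *\<^sub>v ((w $ 0 / A $$ (0, j)) \<cdot>\<^sub>v unit_vec nc j)"
      using A j that by (intro eq_vecI) (auto simp: mult_mat_vec[OF A])
  qed simp
  then have "(\<lambda>v. A *\<^sub>v v) ` carrier_vec nc = carrier_vec 1"
    using A by (auto intro!: mult_mat_vec_carrier)
  then show ?thesis
    using rank_nullity_mat_kernel[OF A] W.dim_is_n by (simp add: module_vec_def)
qed

lemma kernel_dim_full:
  fixes A :: "'a :: field mat"
  assumes A: "A \<in> carrier_mat nr nc" and z: "mat_kernel A = carrier_vec nc"
  shows "kernel_dim A = nc"
proof -
  interpret kernel nr nc A by unfold_locales (rule A)
  show ?thesis using NC.dim_is_n z by (simp add: module_vec_def)
qed

lemma kernel_dim_line: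
  fixes A :: "'a :: field mat"
  assumes A: "A \<in> carrier_mat nr nc" and v: "v \<in> carrier_vec nc"
    and ker: "mat_kernel A = {c \<cdot>\<^sub>v v | c. True}"
  shows "kernel_dim A = (if v = 0\<^sub>v nc then 0 else 1)"
proof -
  interpret kernel nr nc A by unfold_locales (rule A)
  have vk: "v \<in> mat_kernel A" unfolding ker by (metis (mono_tags, lifting) mem_Collect_eq one_smult_vec)
  have "Ker.span {v} = mat_kernel A"
  proof
    show "Ker.span {v} \<subseteq> mat_kernel A" using Ker.span_is_subset2[of "{v}"] vk by simp
    show "mat_kernel A \<subseteq> Ker.span {v}"
      using Ker.span_is_submodule[of "{v}"] Ker.span_self[OF vk] vk
      by (auto simp: ker submodule_def)
  qed
  then show ?thesis using Ker.dim1I[of v] Ker.dim0I vk by auto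
qed

section \<open>Columns of a submatrix\<close>

lemma bij_betw_pick:
  assumes "finite S"
  shows "bij_betw (pick S) {..<card S} S"
proof -
  have "inj_on (pick S) {..<card S}"
  proof (rule linorder_inj_onI)
    fix a b assume "a < b" "b \<in> {..<card S}"
    then show "pick S a \<noteq> pick S b" using pick_mono_le[of b S a] by simp
  qed auto
  moreover have "pick S ` {..<card S} = S"
  proof (rule card_subset_eq[OF assms])
    show "pick S ` {..<card S} \<subseteq> S" by (auto intro: pick_in_set_le)
    show "card (pick S ` {..<card S}) = card S" using calculation by (simp add: card_image)
  qed
  ultimately show ?thesis by (simp add: bij_betw_def)
qed

lemma Collect_less_in_subset:
  "S \<subseteq> {..<n} \<Longrightarrow> {j. j < n \<and> j \<in> S} = S"
  by auto

lemma submatrix_cols_carrier: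
  assumes "T \<subseteq> {..<dim_col M}"
  shows "submatrix M UNIV T \<in> carrier_mat (dim_row M) (card T)"
  by (rule carrier_matI) (simp_all add: dim_submatrix Collect_less_in_subset[OF assms])

text \<open>
  The columns of \<open>submatrix M UNIV T\<close> are renumbered by \<open>pick T\<close>. Reading a vector as a
  function on \<open>T\<close> removes the renumbering: this lemma and \<open>vec_eq_pick\<close> turn
  membership in the kernel into equations between sums over \<open>T\<close>.
\<close>

lemma submatrix_cols_mult_vec:
  fixes M :: "'a :: comm_semiring_0 mat"
  assumes T: "T \<subseteq> {..<dim_col M}"
  shows "submatrix M UNIV T *\<^sub>v vec (card T) (\<lambda>k. f (pick T k))
       = vec (dim_row M) (\<lambda>i. \<Sum>j\<in>T. M $$ (i, j) * f j)"
proof (rule eq_vecI)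
  fix i assume "i < dim_vec (vec (dim_row M) (\<lambda>i. \<Sum>j\<in>T. M $$ (i, j) * f j))"
  then have i: "i < dim_row M" by simp
  have "(submatrix M UNIV T *\<^sub>v vec (card T) (\<lambda>k. f (pick T k))) $ i
      = (\<Sum>k<card T. M $$ (i, pick T k) * f (pick T k))"
    using i Collect_less_in_subset[OF T]
    by (simp add: scalar_prod_def submatrix_def pick_UNIV atLeast0LessThan)
  also have "\<dots> = (\<Sum>j\<in>T. M $$ (i, j) * f j)"
    by (rule sum.reindex_bij_betw[OF bij_betw_pick[OF finite_subset[OF T finite_lessThan]]])
  finally show "(submatrix M UNIV T *\<^sub>v vec (card T) (\<lambda>k. f (pick T k))) $ i
      = vec (dim_row M) (\<lambda>i. \<Sum>j\<in>T. M $$ (i, j) * f j) $ i"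
    using i by simp
qed (simp add: submatrix_def)

lemma vec_eq_pick:
  assumes "finite T" "w \<in> carrier_vec (card T)"
  obtains f where "w = vec (card T) (\<lambda>k. f (pick T k))"
proof -
  define f where "f j = w $ inv_into {..<card T} (pick T) j" for j
  have "f (pick T k) = w $ k" if "k < card T" for k
    using that bij_betw_inv_into_left[OF bij_betw_pick[OF assms(1)], of k] by (simp add: f_def)
  then have "w = vec (card T) (\<lambda>k. f (pick T k))"
    using assms by (intro eq_vecI) auto
  then show ?thesis by (rule that)
qed

section \<open>Nullity types of a circuit and of a cocircuit\<close>

text \<open>
  The orthogonal projection along the indicator vector of \<open>S\<close>. Its kernel is spanned by
  that vector, so the only linear relation among the columns is that those in \<open>S\<close> sum
  to zero.
\<close>

definition circuit_mat :: "nat \<Rightarrow> nat set \<Rightarrow> complex mat" where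
  "circuit_mat n S = mat n n (\<lambda>(i, j).
     (if i = j then 1 else 0) - (if i \<in> S \<and> j \<in> S then 1 / of_nat (card S) else 0))"

text \<open>
  A vector in the kernel of the columns in \<open>T\<close>, extended by zero, equals its own mean
  over \<open>S\<close> at every index of \<open>S\<close> and is zero elsewhere. If \<open>S\<close> is not inside \<open>T\<close>, then
  some entry at an index of \<open>S\<close> is zero by extension, so the mean is zero and the kernel
  is trivial. Otherwise the kernel is the line through the indicator vector of \<open>S\<close>.
\<close>

lemma nullity_type_circuit_mat:
  assumes S: "S \<subseteq> {..<n}" "S \<noteq> {}" and T: "T \<subseteq> {..<n}"
  shows "nullity_type (circuit_mat n S) T = (if S \<subseteq> T then 1 else 0)"
proof -
  define M where "M = circuit_mat n S"
  \<comment> \<open>The spanning vector of the kernel; it is zero unless \<open>S \<subseteq> T\<close>, so both cases are treated at once.\<close>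
  define e where "e j = (if S \<subseteq> T \<and> j \<in> S then 1 else 0 :: complex)" for j
  define v where "v = vec (card T) (\<lambda>k. e (pick T k))"
  have dims: "dim_row M = n" "dim_col M = n" by (simp_all add: M_def circuit_mat_def)
  have fin: "finite S" "finite T" using S T finite_subset by auto
  have A: "submatrix M UNIV T \<in> carrier_mat n (card T)"
    using submatrix_cols_carrier[of T M] T dims by simp
  have row: "(\<Sum>j\<in>T. M $$ (i, j) * f j)
      = (if i \<in> T then f i else 0) - (if i \<in> S then (\<Sum>j\<in>S \<inter> T. f j) / of_nat (card S) else 0)"
    if "i < n" for i f
  proof -
    have "(\<Sum>j\<in>T. M $$ (i, j) * f j)
        = (\<Sum>j\<in>T. (if i = j then f j else 0) - (if i \<in> S then (if j \<in> S then f j / of_nat (card S) else 0) else 0))"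
      using that T by (intro sum.cong) (auto simp: M_def circuit_mat_def left_diff_distrib)
    also have "\<dots> = (if i \<in> T then f i else 0)
        - (if i \<in> S then (\<Sum>j\<in>T. if j \<in> S then f j / of_nat (card S) else 0) else 0)"
      using fin by (simp add: sum_subtractf)
    also have "(\<Sum>j\<in>T. if j \<in> S then f j / of_nat (card S) else 0) = (\<Sum>j\<in>S \<inter> T. f j) / of_nat (card S)"
      using fin by (simp add: sum.inter_restrict[symmetric] Int_commute sum_divide_distrib)
    finally show ?thesis .
  qed
  have ker: "mat_kernel (submatrix M UNIV T) = {c \<cdot>\<^sub>v v | c. True}"
  proof (intro equalityI subsetI)
    fix w assume "w \<in> mat_kernel (submatrix M UNIV T)"
    then have w: "w \<in> carrier_vec (card T)" and Aw: "submatrix M UNIV T *\<^sub>v w = 0\<^sub>v n"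
      using mat_kernelD[OF A] by auto
    obtain f where f: "w = vec (card T) (\<lambda>k. f (pick T k))"
      using vec_eq_pick[OF fin(2) w] .
    define c where "c = (\<Sum>j\<in>S \<inter> T. f j) / of_nat (card S)"
    have entries: "(if i \<in> T then f i else 0) = (if i \<in> S then c else 0)" if "i < n" for i
    proof -
      have "(submatrix M UNIV T *\<^sub>v w) $ i = 0" using Aw that by simp
      then show ?thesis
        using submatrix_cols_mult_vec[of T M f] T dims that row[OF that, of f]
        by (simp add: f c_def)
    qed
    \<comment> \<open>An index in \<open>S - T\<close> has value 0 on the left and the mean \<open>c\<close> on the right.\<close>
    have "c = 0" if "\<not> S \<subseteq> T"
      using that entries S by (metis lessThan_iff subset_iff)
    then have "f i = c * e i" if "i \<in> T" for i
      using entries[of i] that T by (cases "S \<subseteq> T") (auto simp: e_def)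
    then have "w = c \<cdot>\<^sub>v v"
      by (intro eq_vecI) (auto simp: f v_def pick_in_set_le)
    then show "w \<in> {c \<cdot>\<^sub>v v | c. True}" by blast
  next
    fix w assume "w \<in> {c \<cdot>\<^sub>v v | c. True}"
    then obtain c where w: "w = c \<cdot>\<^sub>v v" by blast
    have "sum e (S \<inter> T) = (if S \<subseteq> T then of_nat (card S) else 0)"
      by (auto simp: e_def Int_absorb2)
    then have "(\<Sum>j\<in>T. M $$ (i, j) * e j) = 0" if "i < n" for i
      using row[OF that, of e] S fin by (auto simp: e_def)
    then have "submatrix M UNIV T *\<^sub>v v = 0\<^sub>v n"
      using submatrix_cols_mult_vec[of T M e] T dims by (auto simp: v_def)
    then have "v \<in> mat_kernel (submatrix M UNIV T)"
      by (intro mat_kernelI[OF A]) (auto simp: v_def)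
    then show "w \<in> mat_kernel (submatrix M UNIV T)"
      unfolding w by (rule mat_kernel_smult[OF A])
  qed
  have "kernel_dim (submatrix M UNIV T) = (if v = 0\<^sub>v (card T) then 0 else 1)"
    by (rule kernel_dim_line[OF A _ ker]) (simp add: v_def)
  moreover have "v = 0\<^sub>v (card T) \<longleftrightarrow> \<not> S \<subseteq> T"
  proof
    assume v0: "v = 0\<^sub>v (card T)"
    show "\<not> S \<subseteq> T"
    proof
      assume sub: "S \<subseteq> T"
      obtain s where s: "s \<in> S" using S by blast
      then have "s \<in> pick T ` {..<card T}"
        using sub by (simp add: subset_iff bij_betw_imp_surj_on[OF bij_betw_pick[OF fin(2)]])
      then obtain k where "k < card T" "pick T k = s" by auto
      then show False using arg_cong[OF v0, of "\<lambda>v. v $ k"] s sub by (simp add: v_def e_def)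
    qed
  qed (auto simp: v_def e_def)
  ultimately show ?thesis by (simp add: nullity_type_def M_def)
qed

definition cocircuit_row :: "nat \<Rightarrow> nat set \<Rightarrow> complex mat" where
  "cocircuit_row n S = mat 1 n (\<lambda>(i, j). if j \<in> S then 0 else 1)"

text \<open>
  The rank of the entries in \<open>T\<close> is 0 if they all vanish, that is if \<open>T \<subseteq> S\<close>, and 1
  otherwise. The formula also covers \<open>T = {}\<close>, where it reads \<open>0 - 1 + 1\<close>.
\<close>

lemma nullity_type_cocircuit_row:
  assumes T: "T \<subseteq> {..<n}"
  shows "nullity_type (cocircuit_row n S) T = real (card T) - 1 + (if T \<subseteq> S then 1 else 0)"
proof -
  define A where "A = submatrix (cocircuit_row n S) UNIV T"
  have fin: "finite T" using T finite_subset by auto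
  have A: "A \<in> carrier_mat 1 (card T)"
    using submatrix_cols_carrier[of T "cocircuit_row n S"] T by (simp add: A_def cocircuit_row_def)
  have entry: "A $$ (0, k) = (if pick T k \<in> S then 0 else 1)" if "k < card T" for k
    using that T pick_in_set_le[OF that]
    by (auto simp: A_def cocircuit_row_def submatrix_def Collect_less_in_subset pick_UNIV)
  show ?thesis
  proof (cases "T \<subseteq> S")
    case True
    have "A = 0\<^sub>m 1 (card T)"
      using A entry True pick_in_set_le by (intro eq_matI) auto
    then have "mat_kernel A = carrier_vec (card T)"
      by (auto simp: mat_kernel_def)
    then show ?thesis
      using kernel_dim_full[OF A] True by (simp add: nullity_type_def A_def)
  next
    case False
    then obtain j where "j \<in> pick T ` {..<card T}" "j \<notin> S"
      by (auto simp: subset_iff bij_betw_imp_surj_on[OF bij_betw_pick[OF fin]])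
    then obtain k where k: "k < card T" "pick T k \<notin> S" by auto
    then have "kernel_dim A = card T - 1"
      using kernel_dim_nonzero_row[OF A k(1)] entry by simp
    then show ?thesis
      using False k by (simp add: nullity_type_def A_def of_nat_diff)
  qed
qed

section \<open>Ratios on diagonal matrices\<close>

definition real_diag_mat :: "nat \<Rightarrow> (nat \<Rightarrow> real) \<Rightarrow> complex mat" where
  "real_diag_mat n d = mat n n (\<lambda>(j, k). if j = k then of_real (d j) else 0)"

lemma pos_def_real_diag_mat:
  assumes d: "\<And>j. j < n \<Longrightarrow> d j > 0"
  shows "pos_def_mat n (real_diag_mat n d)"
  unfolding pos_def_mat_def
proof (intro conjI ballI impI)
  show "real_diag_mat n d \<in> carrier_mat n n" by (simp add: real_diag_mat_def)
  show "mat_adjoint (real_diag_mat n d) = real_diag_mat n d"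
    by (intro eq_matI) (auto simp: real_diag_mat_def mat_adjoint_def mat_of_rows_def)
  fix v :: "complex vec" assume v: "v \<in> carrier_vec n" "v \<noteq> 0\<^sub>v n"
  then obtain j where j: "j < n" "v $ j \<noteq> 0" by (metis carrier_vecD eq_vecI index_zero_vec)
  have "(real_diag_mat n d *\<^sub>v v) $ i = of_real (d i) * v $ i" if "i < n" for i
  proof -
    have "(real_diag_mat n d *\<^sub>v v) $ i = (\<Sum>k = 0..<n. (if i = k then of_real (d i) else 0) * v $ k)"
      using that v by (simp add: real_diag_mat_def scalar_prod_def)
    also have "\<dots> = (\<Sum>k = 0..<n. if i = k then of_real (d i) * v $ k else 0)"
      by (rule sum.cong) auto
    finally show ?thesis using that by simp
  qed
  then have "Re ((real_diag_mat n d *\<^sub>v v) \<bullet>c v) = (\<Sum>i = 0..<n. Re (of_real (d i) * v $ i * cnj (v $ i)))"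
    using v by (simp add: scalar_prod_def)
  also have "\<dots> = (\<Sum>i = 0..<n. d i * (cmod (v $ i))\<^sup>2)"
    by (intro sum.cong refl) (simp add: mult.assoc complex_norm_square[symmetric] flip: of_real_mult of_real_power)
  also have "\<dots> > 0"
    using j d by (intro sum_pos2[of _ j]) (auto simp: less_imp_le)
  finally show "Re ((real_diag_mat n d *\<^sub>v v) \<bullet>c v) > 0" .
qed

lemma det_submatrix_real_diag_mat:
  assumes S: "S \<subseteq> {..<n}"
  shows "det (submatrix (real_diag_mat n d) S S) = of_real (\<Prod>j\<in>S. d j)"
proof -
  define A where "A = submatrix (real_diag_mat n d) S S"
  have fin: "finite S" using S finite_subset by auto
  have A: "A \<in> carrier_mat (card S) (card S)"
    using S by (simp add: A_def real_diag_mat_def submatrix_def Collect_less_in_subset)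
  have inj: "inj_on (pick S) {..<card S}" using bij_betw_pick[OF fin] by (simp add: bij_betw_def)
  have entry: "A $$ (a, b) = (if a = b then of_real (d (pick S a)) else 0)" if "a < card S" "b < card S" for a b
  proof -
    have "pick S a < n" "pick S b < n"
      using that S pick_in_set_le[of _ S] by (meson lessThan_iff subsetD)+
    moreover have "pick S a = pick S b \<longleftrightarrow> a = b"
      using that inj_on_eq_iff[OF inj, of a b] by simp
    ultimately show ?thesis
      using that S by (simp add: A_def real_diag_mat_def submatrix_def Collect_less_in_subset)
  qed
  have "det A = prod_list (diag_mat A)"
    using A entry by (intro det_upper_triangular[OF _ A]) auto
  also have "\<dots> = (\<Prod>a<card S. of_real (d (pick S a)))"
    using A entry by (simp add: prod_list_diag_prod lessThan_atLeast0)
  also have "\<dots> = of_real (\<Prod>j\<in>S. d j)"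
    using prod.reindex_bij_betw[OF bij_betw_pick[OF fin], of "\<lambda>j. complex_of_real (d j)"] by simp
  finally show ?thesis unfolding A_def .
qed

lemma sum_total_exponent:
  assumes "finite F"
  shows "(\<Sum>T\<in>F. total_exponent \<alpha> T) = (\<Sum>(T, \<eta>) \<leftarrow> \<alpha>. if T \<in> F then \<eta> else 0)"
  using assms
  by (induction \<alpha>) (auto simp: total_exponent_def sum.distrib)

lemma product_value_diag:
  assumes \<alpha>: "\<alpha> \<in> minor_products n" and i: "i < n"
  shows "product_value \<alpha> (real_diag_mat n (\<lambda>j. if j = i then 2 else 1))
       = 2 powr (\<Sum>T | T \<subseteq> {..<n} \<and> i \<in> T. total_exponent \<alpha> T)"
proof -
  have fin: "finite {T. T \<subseteq> {..<n} \<and> i \<in> T}" by simp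
  have "product_value \<alpha> (real_diag_mat n (\<lambda>j. if j = i then 2 else 1))
      = 2 powr (\<Sum>(T, \<eta>) \<leftarrow> \<alpha>. if T \<in> {T. T \<subseteq> {..<n} \<and> i \<in> T} then \<eta> else 0)"
    using \<alpha>
  proof (induction \<alpha>)
    case (Cons p \<alpha>)
    obtain S \<eta> where p: "p = (S, \<eta>)" by force
    have S: "S \<subseteq> {..<n}" and "\<alpha> \<in> minor_products n"
      using Cons.prems p by (auto simp: minor_products_def)
    moreover have "(\<Prod>j\<in>S. if j = i then 2 else 1 :: real) = (if i \<in> S then 2 else 1)"
      using S finite_subset[OF S] by simp
    ultimately show ?case
      using Cons.IH by (auto simp: p product_value_def det_submatrix_real_diag_mat powr_add)
  qed (simp add: product_value_def)
  then show ?thesis by (simp only: sum_total_exponent[OF fin])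
qed

text \<open>
  Scaling the index \<open>i\<close> alone by 2 multiplies the ratio by 2 to the power of this sum, so
  a homogeneous ratio has degree zero in every index. The sets in the sum contain \<open>i\<close>, so
  the special value of the formal logarithm at the empty set does not enter.
\<close>

lemma homogeneous_imp_degree_zero:
  assumes r: "r \<in> ratio_exprs n" and hom: "homogeneous_ratio n r" and i: "i < n"
  shows "(\<Sum>T | T \<subseteq> {..<n} \<and> i \<in> T. formal_log n r T) = 0"
proof -
  let ?D = "real_diag_mat n (\<lambda>j. if j = i then 2 else 1)"
  let ?F = "{T. T \<subseteq> {..<n} \<and> i \<in> T}"
  have "pos_def_mat n ?D" by (rule pos_def_real_diag_mat) simp
  moreover have "diagonal_mat ?D" by (auto simp: diagonal_mat_def real_diag_mat_def)
  ultimately have "ratio_value r ?D = 1" using hom by (auto simp: homogeneous_ratio_def)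
  moreover have "fst r \<in> minor_products n" "snd r \<in> minor_products n"
    using r by (auto simp: ratio_exprs_def)
  ultimately have "2 powr ((\<Sum>T\<in>?F. total_exponent (fst r) T) - (\<Sum>T\<in>?F. total_exponent (snd r) T)) = (1::real)"
    using i by (simp add: ratio_value_def product_value_diag powr_diff)
  then have "(\<Sum>T\<in>?F. total_exponent (fst r) T) - (\<Sum>T\<in>?F. total_exponent (snd r) T) = 0"
    by simp
  moreover have "(\<Sum>T\<in>?F. formal_log n r T)
      = (\<Sum>T\<in>?F. total_exponent (fst r) T - total_exponent (snd r) T)"
    by (intro sum.cong) (auto simp: formal_log_def)
  ultimately show ?thesis by (simp add: sum_subtractf)
qed

section \<open>Linear identities for formal logarithms\<close>

lemma sum_formal_log: "(\<Sum>T\<in>Pow {..<n}. formal_log n r T) = 0"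
proof -
  have "(\<Sum>T\<in>Pow {..<n}. formal_log n r T)
      = formal_log n r {} + (\<Sum>T\<in>Pow {..<n} - {{}}. formal_log n r T)"
    by (intro sum.remove) auto
  also have "(\<Sum>T\<in>Pow {..<n} - {{}}. formal_log n r T)
      = (\<Sum>T\<in>Pow {..<n} - {{}}. total_exponent (fst r) T - total_exponent (snd r) T)"
    by (intro sum.cong) (auto simp: formal_log_def)
  finally show ?thesis by (simp add: formal_log_def)
qed

text \<open>Cardinality is the sum over \<open>i\<close> of the indicators of \<open>i \<in> T\<close>.\<close>

lemma sum_formal_log_card:
  assumes "r \<in> ratio_exprs n" "homogeneous_ratio n r"
  shows "(\<Sum>T\<in>Pow {..<n}. formal_log n r T * real (card T)) = 0"
proof -
  have "(\<Sum>T\<in>Pow {..<n}. formal_log n r T * real (card T))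
      = (\<Sum>T\<in>Pow {..<n}. \<Sum>i<n. if i \<in> T then formal_log n r T else 0)"
  proof (intro sum.cong refl)
    fix T assume "T \<in> Pow {..<n}"
    then have "{i. i < n \<and> i \<in> T} = T" by auto
    then show "formal_log n r T * real (card T) = (\<Sum>i<n. if i \<in> T then formal_log n r T else 0)"
      by (simp add: sum.If_cases Int_def mult.commute)
  qed
  also have "\<dots> = (\<Sum>i<n. \<Sum>T\<in>Pow {..<n}. if i \<in> T then formal_log n r T else 0)"
    by (rule sum.swap)
  also have "\<dots> = (\<Sum>i<n. \<Sum>T | T \<subseteq> {..<n} \<and> i \<in> T. formal_log n r T)"
    by (simp add: sum.If_cases Int_def)
  also have "\<dots> = 0" using homogeneous_imp_degree_zero[OF assms] by simp
  finally show ?thesis .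
qed

section \<open>The inclusion\<close>

theorem corollary5:
  fixes n :: nat
  assumes "n \<ge> 1"
  shows "\<D> n \<subseteq> \<E> n"
  unfolding \<D>_def \<E>_def
proof (intro image_mono Collect_mono impI, elim conjE, intro conjI allI impI)
  fix r S
  let ?c = "formal_log n r"
  assume S: "S \<subseteq> {..<n}"
    and r: "r \<in> ratio_exprs n" "homogeneous_ratio n r"
    and nul: "\<forall>M. dim_col M = n \<longrightarrow> (\<Sum>T\<in>Pow {..<n}. ?c T * nullity_type M T) \<ge> 0"
  show "(\<Sum>T | S \<subseteq> T \<and> T \<subseteq> {..<n}. ?c T) \<ge> 0"
  proof (cases "S = {}")
    case True
    then show ?thesis using sum_formal_log[of n r] by (simp add: Pow_def)
  next
    case False
    have "(\<Sum>T | S \<subseteq> T \<and> T \<subseteq> {..<n}. ?c T)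
        = (\<Sum>T\<in>Pow {..<n}. if S \<subseteq> T then ?c T else 0)"
      by (simp add: sum.If_cases Int_def conj_commute)
    also have "\<dots> = (\<Sum>T\<in>Pow {..<n}. ?c T * nullity_type (circuit_mat n S) T)"
      using nullity_type_circuit_mat[OF S False] by (intro sum.cong) auto
    also have "\<dots> \<ge> 0" using nul by (simp add: circuit_mat_def)
    finally show ?thesis .
  qed
  have "(\<Sum>T\<in>Pow S. ?c T) = (\<Sum>T\<in>Pow {..<n}. if T \<subseteq> S then ?c T else 0)"
    using S by (auto simp: sum.If_cases intro!: sum.cong)
  \<comment> \<open>Both added sums are zero; they complete the indicator to a nullity type.\<close>
  also have "\<dots> = (\<Sum>T\<in>Pow {..<n}. ?c T * real (card T)) - (\<Sum>T\<in>Pow {..<n}. ?c T)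
        + (\<Sum>T\<in>Pow {..<n}. if T \<subseteq> S then ?c T else 0)"
    using sum_formal_log_card[OF r] sum_formal_log[of n r] by simp
  also have "\<dots> = (\<Sum>T\<in>Pow {..<n}. ?c T * nullity_type (cocircuit_row n S) T)"
    unfolding sum_subtractf[symmetric] sum.distrib[symmetric]
    by (intro sum.cong refl) (auto simp: nullity_type_cocircuit_row algebra_simps)
  also have "\<dots> \<ge> 0" using nul by (simp add: cocircuit_row_def)
  finally show "(\<Sum>T\<in>Pow S. ?c T) \<ge> 0" .
qed

end
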